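(* Let $G$ be a rotor graph, $(\rho,\sigma)$ a rotor-particle configuration, and $(\rho_1,\sigma_1)\in\mathrm{routing}^\infty(\rho,\sigma)$. Then a rotor-particle configuration $(\rho_2,\sigma_2)$ belongs to $\mathrm{routing}^\infty(\rho,\sigma)$ if and only if $\rho_1\sim\rho_2$ and $\sigma_1=\sigma_2$.
   Context: A rotor graph is a stopping directed multigraph $G=(V,A,\mathrm{head},\mathrm{tail})$ (every vertex has a directed path to a sink, i.e. a vertex of outdegree $0$) with a rotor order: a bijection $\theta:A\to A$ which, for each vertex $u$ in the set $V_0$ of non-sink vertices, permutes the set $A^+(u)$ of arcs out of $u$ as a single cycle. A rotor configuration is a map $\rho:V_0\to A$ with $\rho(u)\in A^+(u)$ ($\mathcal{R}$ is their set); a particle configuration is a map $\sigma:V\to\mathbb{Z}$ ($\Sigma$ their group; a vertex $u$ is identified with the configuration with one particle on $u$). For $u\in V_0$, $\mathrm{routing}^+_u(\rho,\sigma)=(\rho',\sigma+\mathrm{head}(\rho(u))-u)$ where $\rho'$ equals $\rho$ except $\rho'(u)=\theta(\rho(u))$; these are commuting bijections; for $r:V_0\to\mathbb{Z}$, $\mathrm{routing}^r$ composes the $(\mathrm{routing}^+_u)^{r(u)}$ (negative powers = inverses). $(\rho,\sigma)\sim(\rho',\sigma')$ iff $\mathrm{routing}^r(\rho,\sigma)=(\rho',\sigma')$ for some $r$; $\rho\sim\rho'$ iff $(\rho,\sigma)\sim(\rho',\sigma)$ for some $\sigma$. $\mathrm{routing}^\infty(\rho,\sigma)$ is the set of $(\rho',\sigma')\sim(\rho,\sigma)$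 with $\sigma'(u)=0$ for all $u\in V_0$. *)

theory Defs
  imports "Graph_Theory.Digraph" "HOL-Combinatorics.Orbits"
begin

definition sinks :: "('v, 'a) pre_digraph \<Rightarrow> 'v set" where
  "sinks G = {v \<in> verts G. out_degree G v = 0}"

definition nonsinks :: "('v, 'a) pre_digraph \<Rightarrow> 'v set" where
  "nonsinks G = verts G - sinks G"

definition stopping :: "('v, 'a) pre_digraph \<Rightarrow> bool" where
  "stopping G \<longleftrightarrow> (\<forall>u\<in>verts G. \<exists>s\<in>sinks G. u \<rightarrow>\<^sup>*\<^bsub>G\<^esub> s)"

text \<open>
  A bijection of the arc set is represented by its unique extension to the whole type that is
  the identity outside of the arc set.
\<close>

definition rotor_order :: "('v, 'a) pre_digraph \<Rightarrow> ('a \<Rightarrow> 'a) \<Rightarrow> bool" where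
  "rotor_order G \<theta> \<longleftrightarrow>
     \<theta> permutes arcs G \<and> (\<forall>u\<in>nonsinks G. cyclic_on \<theta> (out_arcs G u))"

locale rotor_graph = fin_digraph G for G :: "('v, 'a) pre_digraph" +
  fixes \<theta> :: "'a \<Rightarrow> 'a"
  assumes stopping: "stopping G"
    and rotor_order: "rotor_order G \<theta>"

text \<open>
  Configurations are functions on the whole vertex type: rotor configurations are
  \<open>undefined\<close> outside the non-sink vertices and particle configurations vanish outside the
  vertex set, so that equality of functions is equality of configurations.
\<close>

definition rotor_configs :: "('v, 'a) pre_digraph \<Rightarrow> ('v \<Rightarrow> 'a) set" where
  "rotor_configs G = (\<Pi>\<^sub>E u\<in>nonsinks G. out_arcs G u)"

definition particle_configs :: "('v, 'a) pre_digraph \<Rightarrow> ('v \<Rightarrow> int) set" where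
  "particle_configs G = {\<sigma>. \<forall>v. v \<notin> verts G \<longrightarrow> \<sigma> v = 0}"

definition rotor_particle_configs ::
    "('v, 'a) pre_digraph \<Rightarrow> (('v \<Rightarrow> 'a) \<times> ('v \<Rightarrow> int)) set" where
  "rotor_particle_configs G = rotor_configs G \<times> particle_configs G"

definition particle :: "'v \<Rightarrow> 'v \<Rightarrow> int" where
  "particle u = (\<lambda>v. if v = u then 1 else 0)"

definition routing_plus :: "('v, 'a) pre_digraph \<Rightarrow> ('a \<Rightarrow> 'a) \<Rightarrow> 'v \<Rightarrow>
    ('v \<Rightarrow> 'a) \<times> ('v \<Rightarrow> int) \<Rightarrow> ('v \<Rightarrow> 'a) \<times> ('v \<Rightarrow> int)" where
  "routing_plus G \<theta> u = (\<lambda>(\<rho>, \<sigma>).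
     (\<rho>(u := \<theta> (\<rho> u)), \<lambda>v. \<sigma> v + particle (head G (\<rho> u)) v - particle u v))"

text \<open>
  If \<open>\<theta>\<close> is a rotor order and \<open>u\<close> is a non-sink vertex, then \<open>routing_plus G \<theta> u\<close> is
  a bijection both on the whole type and on the rotor-particle configurations (proved below),
  so \<open>inv\<close> is its inverse.
\<close>

definition routing_power :: "('v, 'a) pre_digraph \<Rightarrow> ('a \<Rightarrow> 'a) \<Rightarrow> 'v \<Rightarrow> int \<Rightarrow>
    ('v \<Rightarrow> 'a) \<times> ('v \<Rightarrow> int) \<Rightarrow> ('v \<Rightarrow> 'a) \<times> ('v \<Rightarrow> int)" where
  "routing_power G \<theta> u k =
     (if k \<ge> 0 then routing_plus G \<theta> u ^^ nat k else inv (routing_plus G \<theta> u) ^^ nat (- k))"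

text \<open>
  The composition over the finite set of non-sink vertices; the order is irrelevant because the
  factors commute. Only the values of \<open>r\<close> on non-sink vertices matter.
\<close>

definition routing :: "('v, 'a) pre_digraph \<Rightarrow> ('a \<Rightarrow> 'a) \<Rightarrow> ('v \<Rightarrow> int) \<Rightarrow>
    ('v \<Rightarrow> 'a) \<times> ('v \<Rightarrow> int) \<Rightarrow> ('v \<Rightarrow> 'a) \<times> ('v \<Rightarrow> int)" where
  "routing G \<theta> r c = Finite_Set.fold (\<lambda>u. routing_power G \<theta> u (r u)) c (nonsinks G)"

definition config_equiv :: "('v, 'a) pre_digraph \<Rightarrow> ('a \<Rightarrow> 'a) \<Rightarrow>
    ('v \<Rightarrow> 'a) \<times> ('v \<Rightarrow> int) \<Rightarrow> ('v \<Rightarrow> 'a) \<times> ('v \<Rightarrow> int) \<Rightarrow> bool" where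
  "config_equiv G \<theta> c c' \<longleftrightarrow>
     c \<in> rotor_particle_configs G \<and> c' \<in> rotor_particle_configs G \<and>
     (\<exists>r. routing G \<theta> r c = c')"

definition rotor_equiv :: "('v, 'a) pre_digraph \<Rightarrow> ('a \<Rightarrow> 'a) \<Rightarrow>
    ('v \<Rightarrow> 'a) \<Rightarrow> ('v \<Rightarrow> 'a) \<Rightarrow> bool" where
  "rotor_equiv G \<theta> \<rho> \<rho>' \<longleftrightarrow>
     (\<exists>\<sigma>\<in>particle_configs G. config_equiv G \<theta> (\<rho>, \<sigma>) (\<rho>', \<sigma>))"

definition routing_infinity :: "('v, 'a) pre_digraph \<Rightarrow> ('a \<Rightarrow> 'a) \<Rightarrow>
    ('v \<Rightarrow> 'a) \<times> ('v \<Rightarrow> int) \<Rightarrow> (('v \<Rightarrow> 'a) \<times> ('v \<Rightarrow> int)) set" where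
  "routing_infinity G \<theta> c =
     {(\<rho>', \<sigma>'). config_equiv G \<theta> c (\<rho>', \<sigma>') \<and> (\<forall>u\<in>nonsinks G. \<sigma>' u = 0)}"

lemma bij_routing_plus:
  assumes "bij \<theta>"
  shows "bij (routing_plus G \<theta> u)"
proof (rule o_bij)
  let ?g = "\<lambda>(\<rho>, \<sigma>). (\<rho>(u := inv \<theta> (\<rho> u)),
     \<lambda>v. \<sigma> v - particle (head G (inv \<theta> (\<rho> u))) v + particle u v)"
  have "inv \<theta> (\<theta> x) = x" "\<theta> (inv \<theta> x) = x" for x
    using assms by (simp_all add: bij_is_inj bij_is_surj surj_f_inv_f)
  then show "?g \<circ> routing_plus G \<theta> u = id" "routing_plus G \<theta> u \<circ> ?g = id"
    by (auto simp: routing_plus_def fun_eq_iff)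
qed

lemma routing_plus_commute:
  "routing_plus G \<theta> u \<circ> routing_plus G \<theta> v = routing_plus G \<theta> v \<circ> routing_plus G \<theta> u"
  by (cases "u = v") (auto simp: routing_plus_def fun_eq_iff)

lemma commute_inv:
  assumes "bij f" "f \<circ> g = g \<circ> f"
  shows "inv f \<circ> g = g \<circ> inv f"
proof
  fix x
  have "f (g (inv f x)) = g x"
    using fun_cong[OF assms(2), of "inv f x"] assms(1) by (simp add: bij_is_surj surj_f_inv_f)
  then show "(inv f \<circ> g) x = (g \<circ> inv f) x"
    using assms(1) by (metis bij_inv_eq_iff comp_apply)
qed

lemma commute_funpow:
  assumes "f \<circ> g = g \<circ> f"
  shows "(f ^^ n) \<circ> g = g \<circ> (f ^^ n)"
  using assms by (induction n) (auto simp: fun_eq_iff)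

lemma routing_power_commute:
  assumes "bij \<theta>"
  shows "routing_power G \<theta> u j \<circ> routing_power G \<theta> v k =
         routing_power G \<theta> v k \<circ> routing_power G \<theta> u j"
proof -
  have *: "routing_power G \<theta> u j \<circ> g = g \<circ> routing_power G \<theta> u j"
    if "routing_plus G \<theta> u \<circ> g = g \<circ> routing_plus G \<theta> u" for u j g
    using commute_funpow[OF that] commute_funpow[OF commute_inv[OF bij_routing_plus[OF assms] that]]
    by (simp add: routing_power_def)
  show ?thesis
    by (intro *) (rule *[symmetric], rule routing_plus_commute)
qed

context rotor_graph
begin

lemma bij_theta: "bij \<theta>"
  using rotor_order by (auto simp: rotor_order_def intro: permutes_bij)

lemma theta_out_arcs: "u \<in> nonsinks G \<Longrightarrow> \<theta> a \<in> out_arcs G u \<longleftrightarrow> a \<in> out_arcs G u"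
  using rotor_order by (auto simp only: rotor_order_def intro: cyclic_on_inI cyclic_on_f_in)

lemma bij_betw_routing_plus:
  assumes "u \<in> nonsinks G"
  shows "bij_betw (routing_plus G \<theta> u) (rotor_particle_configs G) (rotor_particle_configs G)"
proof -
  have u: "u \<in> verts G"
    using assms by (simp add: nonsinks_def)
  have *: "routing_plus G \<theta> u c \<in> rotor_particle_configs G \<longleftrightarrow> c \<in> rotor_particle_configs G" for c
  proof -
    obtain \<rho> \<sigma> where c: "c = (\<rho>, \<sigma>)" by (cases c)
    have 1: "\<rho>(u := \<theta> (\<rho> u)) \<in> rotor_configs G \<longleftrightarrow> \<rho> \<in> rotor_configs G"
      using theta_out_arcs[of _ "\<rho> u"] assms
      unfolding rotor_configs_def PiE_iff extensional_def by (auto simp del: in_out_arcs_conv) metis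
    have 2: "(\<lambda>v. \<sigma> v + particle (head G (\<rho> u)) v - particle u v) \<in> particle_configs G
        \<longleftrightarrow> \<sigma> \<in> particle_configs G" if "\<rho> \<in> rotor_configs G"
    proof -
      have "head G (\<rho> u) \<in> verts G"
        using that assms by (auto simp: rotor_configs_def PiE_iff)
      then show ?thesis
        using u by (auto simp: particle_configs_def particle_def) metis
    qed
    from 1 2 show ?thesis
      by (auto simp: c routing_plus_def rotor_particle_configs_def)
  qed
  have bij: "bij (routing_plus G \<theta> u)"
    by (rule bij_routing_plus[OF bij_theta])
  have "routing_plus G \<theta> u ` rotor_particle_configs G = rotor_particle_configs G"
  proof
    show "routing_plus G \<theta> u ` rotor_particle_configs G \<subseteq> rotor_particle_configs G"
      using * by auto
    show "rotor_particle_configs G \<subseteq> routing_plus G \<theta> u ` rotor_particle_configs G"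
    proof
      fix c assume c: "c \<in> rotor_particle_configs G"
      obtain d where "c = routing_plus G \<theta> u d"
        using bij by (metis bij_pointE)
      with c * show "c \<in> routing_plus G \<theta> u ` rotor_particle_configs G" by auto
    qed
  qed
  then show ?thesis
    using bij by (auto simp: bij_betw_def intro: inj_on_subset)
qed

lemma comp_fun_commute_routing_power:
  "comp_fun_commute_on UNIV (\<lambda>u. routing_power G \<theta> u (r u))"
  by unfold_locales (simp add: routing_power_commute[OF bij_theta])

end

end

theory Submission
  imports Defs
begin

text \<open>
  Routing is an action of the integer vectors on configurations, and it changes the particle
  configuration by an amount depending only on the rotors; this yields everything except that
  \<open>\<sigma>1\<close> and \<open>\<sigma>2\<close> agree on the sinks. For that, view a routing vector \<open>r\<close> joining two
  configurations without particles on the non-sinks as a flow, conserved at every non-sink.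
  All arcs leaving the set \<open>{r > 0}\<close> carry a nonnegative flow and all arcs entering it a
  nonpositive one; by conservation both totals vanish, so nothing flows from \<open>{r > 0}\<close> to the
  sinks. The set \<open>{r < 0}\<close> is treated symmetrically.
\<close>

section \<open>Conserved flows on a finite vertex set\<close>

lemma no_flow_leaves_positive_part:
  fixes P :: "'v \<Rightarrow> 'v \<Rightarrow> 'b::linordered_ab_group_add"
  assumes V: "finite V" "N \<subseteq> V"
    and nonneg: "\<And>u v. u \<in> N \<Longrightarrow> r u \<ge> 0 \<Longrightarrow> P u v \<ge> 0"
    and nonpos: "\<And>u v. u \<in> N \<Longrightarrow> r u \<le> 0 \<Longrightarrow> P u v \<le> 0"
    and outflow: "\<And>u. u \<in> N \<Longrightarrow> (\<Sum>v\<in>V. P u v) = r u"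
    and inflow: "\<And>v. v \<in> N \<Longrightarrow> (\<Sum>u\<in>N. P u v) = r v"
    and uv: "u \<in> N" "r u > 0" "v \<in> V - N"
  shows "P u v = 0"
proof -
  define U where "U = {u \<in> N. r u > 0}"
  have U: "U \<subseteq> N" "U \<subseteq> V" "finite U" "finite N"
    using V by (auto simp: U_def intro: finite_subset)
  \<comment> \<open>Flow balance of \<open>U\<close>: by \<open>outflow\<close>, what leaves
    \<open>U\<close> is the total of \<open>r\<close> on \<open>U\<close> minus the internal flow;
    by \<open>inflow\<close>, so is what enters \<open>U\<close> from \<open>N - U\<close>. The
    latter is nonpositive because \<open>r\<close> is nonpositive on \<open>N - U\<close>.\<close>
  have "(\<Sum>u\<in>U. \<Sum>v\<in>V - U. P u v) = (\<Sum>u\<in>U. r u) - (\<Sum>u\<in>U. \<Sum>v\<in>U. P u v)"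
    using V U by (simp add: sum_diff sum_subtractf outflow subset_iff)
  also have "(\<Sum>u\<in>U. \<Sum>v\<in>U. P u v) = (\<Sum>v\<in>U. \<Sum>u\<in>U. P u v)"
    by (rule sum.swap)
  also have "(\<Sum>u\<in>U. r u) - \<dots> = (\<Sum>v\<in>U. \<Sum>u\<in>N - U. P u v)"
    using U by (simp add: sum_diff sum_subtractf inflow subset_iff)
  also have "\<dots> \<le> 0"
    by (intro sum_nonpos nonpos) (auto simp: U_def)
  finally have le: "(\<Sum>u\<in>U. \<Sum>v\<in>V - U. P u v) \<le> 0" .
  have P: "P u v \<ge> 0" if "u \<in> U" for u v
    using that by (intro nonneg) (auto simp: U_def)
  have "(\<Sum>u\<in>U. \<Sum>v\<in>V - U. P u v) = 0"
    using le P by (intro antisym sum_nonneg) auto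
  then have "\<forall>u\<in>U. (\<Sum>v\<in>V - U. P u v) = 0"
    using U(3) P by (subst (asm) sum_nonneg_eq_0_iff) (auto intro: sum_nonneg)
  then have "(\<Sum>v\<in>V - U. P u v) = 0"
    using uv by (auto simp: U_def)
  moreover have "u \<in> U" "v \<in> V - U"
    using uv by (auto simp: U_def)
  ultimately show ?thesis
    using V(1) P by (subst (asm) sum_nonneg_eq_0_iff) auto
qed

text \<open>Negating both \<open>r\<close> and \<open>P\<close> exchanges the two sign hypotheses
  and preserves both balance equations, which reduces \<open>r u < 0\<close> to the positive case.
  For \<open>r u = 0\<close> the two sign hypotheses apply at once.\<close>

lemma conserved_flow_vanishes_outside:
  fixes P :: "'v \<Rightarrow> 'v \<Rightarrow> 'b::linordered_ab_group_add"
  assumes V: "finite V" "N \<subseteq> V"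
    and nonneg: "\<And>u v. u \<in> N \<Longrightarrow> r u \<ge> 0 \<Longrightarrow> P u v \<ge> 0"
    and nonpos: "\<And>u v. u \<in> N \<Longrightarrow> r u \<le> 0 \<Longrightarrow> P u v \<le> 0"
    and outflow: "\<And>u. u \<in> N \<Longrightarrow> (\<Sum>v\<in>V. P u v) = r u"
    and inflow: "\<And>v. v \<in> N \<Longrightarrow> (\<Sum>u\<in>N. P u v) = r v"
    and uv: "u \<in> N" "v \<in> V - N"
  shows "P u v = 0"
proof (cases "r u" "0::'b" rule: linorder_cases)
  case greater
  show ?thesis
    by (rule no_flow_leaves_positive_part[of V N r P]) (use assms greater in auto)
next
  case equal
  then show ?thesis
    using nonneg[of u v] nonpos[of u v] uv by auto
next
  case less
  have "- P u v = 0"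
    by (rule no_flow_leaves_positive_part[of V N "\<lambda>u. - r u" "\<lambda>u v. - P u v"])
      (use assms less in \<open>auto simp: sum_negf\<close>)
  then show ?thesis by simp
qed

section \<open>Routing as a group action of integer vectors\<close>

context rotor_graph
begin

lemma finite_nonsinks: "finite (nonsinks G)"
  by (simp add: nonsinks_def)

lemma routing_plus_inv: "routing_plus G \<theta> u (inv (routing_plus G \<theta> u) c) = c"
  by (rule surj_f_inv_f[OF bij_is_surj[OF bij_routing_plus[OF bij_theta]]])

lemma inv_routing_plus:
  "inv (routing_plus G \<theta> u) (\<rho>, \<sigma>) =
     (\<rho>(u := inv \<theta> (\<rho> u)),
      \<lambda>v. \<sigma> v - particle (head G (inv \<theta> (\<rho> u))) v + particle u v)"
proof -
  have "\<theta> (inv \<theta> (\<rho> u)) = \<rho> u"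
    using bij_theta by (simp add: bij_is_surj surj_f_inv_f)
  then show ?thesis
    by (intro inv_f_eq bij_is_inj[OF bij_routing_plus[OF bij_theta]])
      (auto simp: routing_plus_def)
qed

lemma routing_power_0: "routing_power G \<theta> u 0 = id"
  by (simp add: routing_power_def)

lemma routing_power_succ:
  "routing_power G \<theta> u (k + 1) c = routing_plus G \<theta> u (routing_power G \<theta> u k c)"
proof (cases "k \<ge> 0")
  case True
  then show ?thesis by (simp add: routing_power_def nat_add_distrib)
next
  case False
  \<comment> \<open>For negative \<open>k\<close>, the power at \<open>k\<close> has exactly one
    more inverse factor than the one at \<open>k + 1\<close>, and the forward step cancels
    it.\<close>
  then have "nat (- k) = Suc (nat (- (k + 1)))" by simp
  then have "routing_power G \<theta> u k c =
      inv (routing_plus G \<theta> u) ((inv (routing_plus G \<theta> u) ^^ nat (- (k + 1))) c)"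
    using False by (simp add: routing_power_def)
  moreover have "routing_power G \<theta> u (k + 1) c =
      (inv (routing_plus G \<theta> u) ^^ nat (- (k + 1))) c"
    \<comment> \<open>At \<open>k = -1\<close> the exponent \<open>k + 1\<close> falls into the
      other branch of the definition; both branches give the identity there.\<close>
    using False by (cases "k = -1") (simp_all add: routing_power_def)
  ultimately show ?thesis by (simp only: routing_plus_inv)
qed

lemma routing_power_pred:
  "routing_power G \<theta> u (k - 1) c = inv (routing_plus G \<theta> u) (routing_power G \<theta> u k c)"
proof -
  have "routing_power G \<theta> u k c = routing_plus G \<theta> u (routing_power G \<theta> u (k - 1) c)"
    using routing_power_succ[of u "k - 1" c] by simp
  then show ?thesis
    by (simp only: inv_f_f[OF bij_is_inj[OF bij_routing_plus[OF bij_theta]]])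
qed

lemma routing_power_add:
  "routing_power G \<theta> u (j + k) c = routing_power G \<theta> u j (routing_power G \<theta> u k c)"
proof (induction j rule: int_induct[where k = 0])
  case base
  show ?case by (simp add: routing_power_0)
next
  case (step1 j)
  have "j + 1 + k = j + k + 1" by simp
  then show ?case
    by (simp only: routing_power_succ step1.IH)
next
  case (step2 j)
  have "j - 1 + k = j + k - 1" by simp
  then show ?case
    by (simp only: routing_power_pred step2.IH)
qed

lemma fold_routing_power_insert:
  assumes "finite A" "u \<notin> A"
  shows "Finite_Set.fold (\<lambda>u. routing_power G \<theta> u (r u)) c (insert u A) =
    routing_power G \<theta> u (r u) (Finite_Set.fold (\<lambda>u. routing_power G \<theta> u (r u)) c A)"
  using comp_fun_commute_on.fold_insert[OF comp_fun_commute_routing_power] assms by simp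

text \<open>Since the factors commute, a further power passes through the whole fold to the initial
  configuration. In \<open>routing_add\<close> this brings the two powers at the same vertex next to
  each other.\<close>

lemma routing_power_fold_commute:
  assumes "finite A"
  shows "routing_power G \<theta> v k (Finite_Set.fold (\<lambda>u. routing_power G \<theta> u (r u)) c A) =
    Finite_Set.fold (\<lambda>u. routing_power G \<theta> u (r u)) (routing_power G \<theta> v k c) A"
  using assms
proof (induction A rule: finite_induct)
  case (insert u A)
  then show ?case
    using fun_cong[OF routing_power_commute[OF bij_theta, of G v k u "r u"]]
    by (simp add: fold_routing_power_insert)
qed simp

lemma routing_add: "routing G \<theta> (\<lambda>u. r u + s u) c = routing G \<theta> r (routing G \<theta> s c)"
proof -
  have "Finite_Set.fold (\<lambda>u. routing_power G \<theta> u (r u + s u)) c A =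
      Finite_Set.fold (\<lambda>u. routing_power G \<theta> u (r u))
        (Finite_Set.fold (\<lambda>u. routing_power G \<theta> u (s u)) c A) A" if "finite A" for A
    using that
  proof (induction A rule: finite_induct)
    case (insert u A)
    show ?case
      unfolding fold_routing_power_insert[OF insert.hyps, where r = "\<lambda>u. r u + s u"] insert.IH
      using insert.hyps
      by (simp add: fold_routing_power_insert routing_power_fold_commute[symmetric]
          routing_power_add)
  qed simp
  then show ?thesis
    unfolding routing_def using finite_nonsinks by blast
qed

lemma routing_0: "routing G \<theta> (\<lambda>_. 0) c = c"
proof -
  have "Finite_Set.fold (\<lambda>u. routing_power G \<theta> u 0) c A = c" if "finite A" for A
    using that
  proof (induction A rule: finite_induct)
    case (insert u A)
    show ?case
      unfolding fold_routing_power_insert[OF insert.hyps, where r = "\<lambda>_. 0"] insert.IH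
      by (simp add: routing_power_0)
  qed simp
  then show ?thesis
    unfolding routing_def using finite_nonsinks by blast
qed

lemma config_equiv_sym:
  assumes "config_equiv G \<theta> c d"
  shows "config_equiv G \<theta> d c"
proof -
  obtain r where "routing G \<theta> r c = d"
    using assms by (auto simp: config_equiv_def)
  then have "routing G \<theta> (\<lambda>u. - r u) d = c"
    using routing_add[of "\<lambda>u. - r u" r c] by (simp add: routing_0)
  then show ?thesis
    using assms by (auto simp: config_equiv_def)
qed

lemma config_equiv_trans:
  assumes "config_equiv G \<theta> c d" "config_equiv G \<theta> d e"
  shows "config_equiv G \<theta> c e"
  using assms unfolding config_equiv_def by (metis routing_add)

section \<open>Particles emitted by routing\<close>

lemma rotor_configs_theta:
  assumes "\<rho> \<in> rotor_configs G" "u \<in> nonsinks G"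
  shows "\<rho>(u := \<theta> (\<rho> u)) \<in> rotor_configs G"
  using assms theta_out_arcs[of u "\<rho> u"]
  by (auto simp: rotor_configs_def PiE_iff extensional_def simp del: in_out_arcs_conv)

lemma rotor_configs_inv_theta:
  assumes "\<rho> \<in> rotor_configs G" "u \<in> nonsinks G"
  shows "\<rho>(u := inv \<theta> (\<rho> u)) \<in> rotor_configs G"
proof -
  have "\<theta> (inv \<theta> (\<rho> u)) = \<rho> u"
    using bij_theta by (simp add: bij_is_surj surj_f_inv_f)
  then show ?thesis
    using assms theta_out_arcs[of u "inv \<theta> (\<rho> u)"]
    by (auto simp: rotor_configs_def PiE_iff extensional_def simp del: in_out_arcs_conv)
qed

lemma head_rotor:
  assumes "\<rho> \<in> rotor_configs G" "u \<in> nonsinks G"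
  shows "head G (\<rho> u) \<in> verts G"
  using assms by (auto simp: rotor_configs_def PiE_iff)

lemma sum_particle: "finite V \<Longrightarrow> w \<in> V \<Longrightarrow> (\<Sum>v\<in>V. particle w v) = 1"
  by (simp add: particle_def)

lemma particle_nonneg: "particle w v \<ge> 0"
  by (simp add: particle_def)

text \<open>
  The possible numbers \<open>p v\<close> of particles sent to each \<open>v\<close> by a vertex routed \<open>k\<close> times.
\<close>

definition emission :: "int \<Rightarrow> ('v \<Rightarrow> int) \<Rightarrow> bool" where
  "emission k p \<longleftrightarrow> (\<forall>v. (k \<ge> 0 \<longrightarrow> p v \<ge> 0) \<and> (k \<le> 0 \<longrightarrow> p v \<le> 0)) \<and>
     (\<Sum>v\<in>verts G. p v) = k"

text \<open>Here \<open>\<rho>'\<close> and \<open>p\<close> are chosen before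
  \<open>\<sigma>\<close>: rotors alone determine where particles go, so routing translates
  \<open>\<sigma>\<close>. Staying in \<open>rotor_configs G\<close> keeps every head inside
  \<open>verts G\<close>, so each step changes the total of \<open>p\<close> by exactly one.\<close>

lemma routing_power_emission:
  assumes \<rho>: "\<rho> \<in> rotor_configs G" and u: "u \<in> nonsinks G"
  shows "\<exists>\<rho>'\<in>rotor_configs G. \<exists>p. emission k p \<and>
    (\<forall>\<sigma>. routing_power G \<theta> u k (\<rho>, \<sigma>) = (\<rho>', \<lambda>v. \<sigma> v + p v - k * particle u v))"
proof (induction k rule: int_induct[where k = 0])
  case base
  show ?case
    using \<rho> by (intro bexI[of _ \<rho>] exI[of _ "\<lambda>_. 0"]) (auto simp: emission_def routing_power_0)
next
  case (step1 k)
  then obtain \<rho>' p where *: "\<rho>' \<in> rotor_configs G" "emission k p"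
    "\<And>\<sigma>. routing_power G \<theta> u k (\<rho>, \<sigma>) = (\<rho>', \<lambda>v. \<sigma> v + p v - k * particle u v)"
    by blast
  let ?w = "head G (\<rho>' u)"
  \<comment> \<open>Upward steps start at \<open>k \<ge> 0\<close>, so \<open>p\<close> is
    nonnegative already and the condition for nonpositive counts is vacuous at
    \<open>k + 1\<close>.\<close>
  have "emission (k + 1) (\<lambda>v. p v + particle ?w v)"
    using *(2) step1(1) head_rotor[OF *(1) u]
    by (auto simp: emission_def sum.distrib sum_particle intro: add_nonneg_nonneg particle_nonneg)
  moreover have "routing_power G \<theta> u (k + 1) (\<rho>, \<sigma>) = (\<rho>'(u := \<theta> (\<rho>' u)),
      \<lambda>v. \<sigma> v + (p v + particle ?w v) - (k + 1) * particle u v)" for \<sigma>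
    unfolding routing_power_succ *(3) routing_plus_def by (simp add: fun_eq_iff algebra_simps)
  ultimately show ?case
    using rotor_configs_theta[OF *(1) u] by blast
next
  case (step2 k)
  then obtain \<rho>' p where *: "\<rho>' \<in> rotor_configs G" "emission k p"
    "\<And>\<sigma>. routing_power G \<theta> u k (\<rho>, \<sigma>) = (\<rho>', \<lambda>v. \<sigma> v + p v - k * particle u v)"
    by blast
  \<comment> \<open>Undoing a routing first turns the rotor back, then retrieves a particle along
    the arc it now shows.\<close>
  let ?w = "head G (inv \<theta> (\<rho>' u))"
  have \<rho>'': "\<rho>'(u := inv \<theta> (\<rho>' u)) \<in> rotor_configs G"
    by (rule rotor_configs_inv_theta[OF *(1) u])
  have "p v - particle ?w v \<le> 0" for v
    using *(2) step2(1) particle_nonneg[of ?w v] by (auto simp: emission_def intro: order_trans)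
  then have "emission (k - 1) (\<lambda>v. p v - particle ?w v)"
    using *(2) step2(1) head_rotor[OF \<rho>'' u]
    by (auto simp: emission_def sum_subtractf sum_particle)
  moreover have "routing_power G \<theta> u (k - 1) (\<rho>, \<sigma>) = (\<rho>'(u := inv \<theta> (\<rho>' u)),
      \<lambda>v. \<sigma> v + (p v - particle ?w v) - (k - 1) * particle u v)" for \<sigma>
    unfolding routing_power_pred *(3) inv_routing_plus by (simp add: fun_eq_iff algebra_simps)
  ultimately show ?case
    using \<rho>'' by blast
qed

lemma routing_emission:
  assumes \<rho>: "\<rho> \<in> rotor_configs G"
  shows "\<exists>\<rho>' P. (\<forall>u\<in>nonsinks G. emission (r u) (P u)) \<and>
    (\<forall>\<sigma>. routing G \<theta> r (\<rho>, \<sigma>) =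
      (\<rho>', \<lambda>v. \<sigma> v + (\<Sum>u\<in>nonsinks G. P u v - r u * particle u v)))"
proof -
  \<comment> \<open>Membership in \<open>rotor_configs G\<close> is carried through the induction so
    that \<open>routing_power_emission\<close> applies at the next vertex, starting from the rotors
    reached so far.\<close>
  have "\<exists>\<rho>'\<in>rotor_configs G. \<exists>P. (\<forall>u\<in>A. emission (r u) (P u)) \<and>
    (\<forall>\<sigma>. Finite_Set.fold (\<lambda>u. routing_power G \<theta> u (r u)) (\<rho>, \<sigma>) A =
      (\<rho>', \<lambda>v. \<sigma> v + (\<Sum>u\<in>A. P u v - r u * particle u v)))"
    if "finite A" "A \<subseteq> nonsinks G" for A
    using that
  proof (induction A rule: finite_induct)
    case empty
    then show ?case using \<rho> by auto
  next
    case (insert w A)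
    then obtain \<rho>' P where *: "\<rho>' \<in> rotor_configs G" "\<forall>u\<in>A. emission (r u) (P u)"
      "\<And>\<sigma>. Finite_Set.fold (\<lambda>u. routing_power G \<theta> u (r u)) (\<rho>, \<sigma>) A =
        (\<rho>', \<lambda>v. \<sigma> v + (\<Sum>u\<in>A. P u v - r u * particle u v))"
      by auto
    obtain \<rho>'' p where **: "\<rho>'' \<in> rotor_configs G" "emission (r w) p"
      "\<And>\<sigma>. routing_power G \<theta> w (r w) (\<rho>', \<sigma>) =
        (\<rho>'', \<lambda>v. \<sigma> v + p v - r w * particle w v)"
      using routing_power_emission[OF *(1), of w "r w"] insert.prems by auto
    \<comment> \<open>As \<open>w\<close> is not in \<open>A\<close>, recording its emission leaves
      the earlier summands unchanged.\<close>
    have "(\<Sum>u\<in>A. (P(w := p)) u v - r u * particle u v) =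
        (\<Sum>u\<in>A. P u v - r u * particle u v)" for v
      using insert.hyps by (intro sum.cong) auto
    then have "Finite_Set.fold (\<lambda>u. routing_power G \<theta> u (r u)) (\<rho>, \<sigma>) (insert w A) =
        (\<rho>'', \<lambda>v. \<sigma> v + (\<Sum>u\<in>insert w A. (P(w := p)) u v - r u * particle u v))" for \<sigma>
      using insert.hyps by (simp add: fold_routing_power_insert *(3) **(3) algebra_simps)
    moreover have "\<forall>u\<in>insert w A. emission (r u) ((P(w := p)) u)"
      using *(2) **(2) by simp
    ultimately show ?case
      using **(1) by blast
  qed
  from this[OF finite_nonsinks order_refl] show ?thesis
    unfolding routing_def by (elim bexE) (rule exI)
qed

section \<open>Equivalent configurations and their particles\<close>

text \<open>The shift of particles caused by \<open>r\<close> from \<open>\<rho>1\<close> is the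
  same for every particle configuration. It is zero at \<open>\<sigma>\<close>, hence also at
  \<open>\<sigma>'\<close>, with the same final rotors.\<close>

lemma config_equiv_translate:
  assumes "config_equiv G \<theta> (\<rho>1, \<sigma>) (\<rho>2, \<sigma>)" and "\<sigma>' \<in> particle_configs G"
  shows "config_equiv G \<theta> (\<rho>1, \<sigma>') (\<rho>2, \<sigma>')"
proof -
  from assms(1) have \<rho>: "\<rho>1 \<in> rotor_configs G" "\<rho>2 \<in> rotor_configs G"
    by (auto simp: config_equiv_def rotor_particle_configs_def)
  obtain r where r: "routing G \<theta> r (\<rho>1, \<sigma>) = (\<rho>2, \<sigma>)"
    using assms(1) by (auto simp: config_equiv_def)
  obtain \<rho>' P where "\<forall>\<sigma>. routing G \<theta> r (\<rho>1, \<sigma>) =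
      (\<rho>', \<lambda>v. \<sigma> v + (\<Sum>u\<in>nonsinks G. P u v - r u * particle u v))"
    using routing_emission[OF \<rho>(1), of r] by (elim exE conjE)
  note P = this[rule_format]
  have "routing G \<theta> r (\<rho>1, \<sigma>') = (\<rho>2, \<sigma>')"
    using r P[of \<sigma>] P[of \<sigma>'] by (simp add: fun_eq_iff)
  then show ?thesis
    using \<rho> assms(2) by (auto simp: config_equiv_def rotor_particle_configs_def)
qed

text \<open>Agreement on the non-sinks says that each non-sink receives as many particles as it
  emits, so the emissions form a conserved flow. Such a flow delivers nothing to the sinks, and off
  the vertex set both configurations vanish.\<close>

lemma config_equiv_stable_unique:
  assumes eq: "config_equiv G \<theta> (\<rho>1, \<sigma>1) (\<rho>2, \<sigma>2)"
    and agree: "\<And>u. u \<in> nonsinks G \<Longrightarrow> \<sigma>1 u = \<sigma>2 u"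
  shows "\<sigma>1 = \<sigma>2"
proof -
  from eq have \<rho>: "\<rho>1 \<in> rotor_configs G"
    and \<sigma>: "\<sigma>1 \<in> particle_configs G" "\<sigma>2 \<in> particle_configs G"
    by (auto simp: config_equiv_def rotor_particle_configs_def)
  obtain r where r: "routing G \<theta> r (\<rho>1, \<sigma>1) = (\<rho>2, \<sigma>2)"
    using eq by (auto simp: config_equiv_def)
  obtain \<rho>' P where "\<forall>u\<in>nonsinks G. emission (r u) (P u)"
    "\<forall>\<sigma>. routing G \<theta> r (\<rho>1, \<sigma>) =
      (\<rho>', \<lambda>v. \<sigma> v + (\<Sum>u\<in>nonsinks G. P u v - r u * particle u v))"
    using routing_emission[OF \<rho>, of r] by (elim exE conjE)
  note P = this[rule_format]
  have "(\<Sum>u\<in>nonsinks G. r u * particle u v) = (\<Sum>u\<in>nonsinks G. if u = v then r u else 0)" for v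
    by (intro sum.cong) (auto simp: particle_def)
  \<comment> \<open>The sum of the \<open>r u * particle u v\<close> collapses to the loss at
    \<open>v\<close> itself, which occurs only at non-sinks.\<close>
  then have emitted:
      "\<sigma>2 v = \<sigma>1 v + (\<Sum>u\<in>nonsinks G. P u v) - (if v \<in> nonsinks G then r v else 0)" for v
    using r P(2)[of \<sigma>1] finite_nonsinks by (auto simp: sum_subtractf)
  have "P u v = 0" if "u \<in> nonsinks G" "v \<in> verts G - nonsinks G" for u v
  proof (rule conserved_flow_vanishes_outside[OF finite_verts _ _ _ _ _ that])
    show "nonsinks G \<subseteq> verts G" by (auto simp: nonsinks_def)
    show "(\<Sum>u\<in>nonsinks G. P u v) = r v" if "v \<in> nonsinks G" for v
      using emitted[of v] agree[OF that] that by simp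
  qed (use P(1) in \<open>auto simp: emission_def\<close>)
  then have "\<sigma>1 v = \<sigma>2 v" if "v \<in> verts G - nonsinks G" for v
    using emitted[of v] that by simp
  moreover have "\<sigma>1 v = \<sigma>2 v" if "v \<notin> verts G" for v
    using \<sigma> that by (simp add: particle_configs_def)
  ultimately show ?thesis
    using agree by blast
qed

end

theorem theorem2:
  fixes G :: "('v, 'a) pre_digraph" and \<theta> :: "'a \<Rightarrow> 'a"
    and \<rho> \<rho>1 \<rho>2 :: "'v \<Rightarrow> 'a" and \<sigma> \<sigma>1 \<sigma>2 :: "'v \<Rightarrow> int"
  assumes "rotor_graph G \<theta>"
    and "(\<rho>, \<sigma>) \<in> rotor_particle_configs G"
    and "(\<rho>1, \<sigma>1) \<in> routing_infinity G \<theta> (\<rho>, \<sigma>)"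
    and "(\<rho>2, \<sigma>2) \<in> rotor_particle_configs G"
  shows "(\<rho>2, \<sigma>2) \<in> routing_infinity G \<theta> (\<rho>, \<sigma>) \<longleftrightarrow> rotor_equiv G \<theta> \<rho>1 \<rho>2 \<and> \<sigma>1 = \<sigma>2"
proof -
  interpret rotor_graph G \<theta> by fact
  have 1: "config_equiv G \<theta> (\<rho>, \<sigma>) (\<rho>1, \<sigma>1)" "\<And>u. u \<in> nonsinks G \<Longrightarrow> \<sigma>1 u = 0"
    using assms(3) by (auto simp: routing_infinity_def)
  have \<sigma>1: "\<sigma>1 \<in> particle_configs G"
    using 1(1) by (auto simp: config_equiv_def rotor_particle_configs_def)
  show ?thesis
  proof (intro iffI conjI; (elim conjE)?)
    assume "(\<rho>2, \<sigma>2) \<in> routing_infinity G \<theta> (\<rho>, \<sigma>)"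
    then have 2: "config_equiv G \<theta> (\<rho>, \<sigma>) (\<rho>2, \<sigma>2)" "\<And>u. u \<in> nonsinks G \<Longrightarrow> \<sigma>2 u = 0"
      by (auto simp: routing_infinity_def)
    have 12: "config_equiv G \<theta> (\<rho>1, \<sigma>1) (\<rho>2, \<sigma>2)"
      by (rule config_equiv_trans[OF config_equiv_sym[OF 1(1)] 2(1)])
    show "\<sigma>1 = \<sigma>2"
      by (rule config_equiv_stable_unique[OF 12]) (simp add: 1(2) 2(2))
    with 12 \<sigma>1 show "rotor_equiv G \<theta> \<rho>1 \<rho>2"
      by (auto simp: rotor_equiv_def)
  next
    assume "rotor_equiv G \<theta> \<rho>1 \<rho>2" and [symmetric, simp]: "\<sigma>1 = \<sigma>2"
    \<comment> \<open>\<open>rotor_equiv\<close> provides some particle configuration as witness;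
      translation replaces it by \<open>\<sigma>1\<close>.\<close>
    then have "config_equiv G \<theta> (\<rho>1, \<sigma>1) (\<rho>2, \<sigma>1)"
      unfolding rotor_equiv_def using config_equiv_translate \<sigma>1 by blast
    then show "(\<rho>2, \<sigma>2) \<in> routing_infinity G \<theta> (\<rho>, \<sigma>)"
      using 1(2) config_equiv_trans[OF 1(1)] by (auto simp: routing_infinity_def)
  qed
qed

end
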